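(* Consider a network represented by an undirected graph, with a correct source node broadcasting an information $m$, some set of Byzantine nodes, and all correct nodes running the trigger protocol with parameter $H \geq 1$. Let $D$ be the smallest hop distance between two distinct Byzantine nodes. If $D \geq H+2$, then in every execution no correct node delivers a false message, i.e. no correct node ever delivers any $m' \neq m$.
   Context: **Network.** The network is an undirected graph $(G,E)$; $G$ is the set of nodes (each with a unique identifier) and $E$ the neighborhood relation. A node can send messages only to its neighbors. Each node is either correct (it follows the protocol below) or Byzantine (it behaves arbitrarily, sending arbitrary messages to its neighbors at any time). A distinguished node, the source, is correct; its identity is known. Correct nodes do not know which nodes are Byzantine. To multicast a message is to send it to all one's neighbors. **Execution model.** Message passing is asynchronous: every message sent is eventually received, after an arbitrary finite delay, and in an infinite execution every process is activated infinitely often, in arbitrary order. Channels are authenticated: when a node receives a message from a neighbor $q$, it knows that $q$ sent it (so a Byzantine node cannot lie about its identity to its direct neighbors, but it can put arbitrary content in its messages). An execution is any sequence of events compatible with these rules, the protocol at correct nodes, and arbitrary behavior of Byzantine nodes. **Protocol (parameter $H \geq 1$ known to all correct nodes).** There are standard messages $(m)$ and trigger messages $(m,S)$, where $S$ is a set of node identifiers. Each correct node keeps two sets $Wait$ and $Trig$, initially empty. Initially the source multicasts $(m)$ and $(m,\emptyset)$, where $m$ is the authentic message (the source is regarded as having delivered $m$). Then each correct node follows three rules (in which $m$ stands for an arbitrary message content): - RECEPTION: when a standard message $(m)$ is received from a neighbor $q$: if $q$ is the source, deliver $m$, then multicast $(m)$ and $(m,\emptyset)$; otherwise add $(m,q)$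 to $Wait$. - TRANSMISSION: when a trigger message $(m,S)$ is received from a neighbor $q$: if $q \notin S$ and $|S| \leq H-1$, add $(m,S\cup\{q\})$ to $Trig$ and multicast $(m,S\cup\{q\})$. - DECISION: when there exist $m,q,S$ with $(m,q)\in Wait$, $(m,S)\in Trig$ and $q\notin S$: deliver $m$, then multicast $(m)$ and $(m,\emptyset)$. **Distance $D$.** $D$ is the smallest number of hops (graph distance) between two distinct Byzantine nodes; if there are fewer than two Byzantine nodes, $D=\infty$. *)

theory Defs
  imports Main "HOL-Library.Multiset" "HOL-Library.Extended_Nat"
begin

text \<open>
  Nodes are identified with their identifiers, of type \<open>'a\<close>. The type may contain values that are
  not nodes, so Byzantine nodes can also put made-up identifiers in their messages.
\<close>

record 'a network =
  nodes :: "'a set"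
  edges :: "('a \<times> 'a) set"
  source :: 'a
  byzantine :: "'a set"

definition wf_network :: "'a network \<Rightarrow> bool" where
  "wf_network N \<longleftrightarrow>
     edges N \<subseteq> nodes N \<times> nodes N \<and> sym (edges N) \<and>
     byzantine N \<subseteq> nodes N \<and> source N \<in> nodes N - byzantine N"

definition correct :: "'a network \<Rightarrow> 'a set" where
  "correct N = nodes N - byzantine N"

text \<open>Both infima are taken in \<^typ>\<open>enat\<close>, so the infimum of the empty set is \<open>\<infinity>\<close>.\<close>

definition hop_dist :: "'a network \<Rightarrow> 'a \<Rightarrow> 'a \<Rightarrow> enat" where
  "hop_dist N u v = (INF n \<in> {n. (u, v) \<in> edges N ^^ n}. enat n)"

definition byz_dist :: "'a network \<Rightarrow> enat" where
  "byz_dist N =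
     (INF (u, v) \<in> {(u, v). u \<in> byzantine N \<and> v \<in> byzantine N \<and> u \<noteq> v}. hop_dist N u v)"

datatype ('a, 'm) msg = Std 'm | Trigger 'm "'a set"

text \<open>
  \<open>chan c q p\<close> holds the messages sent by \<open>q\<close> to \<open>p\<close> and not yet received. Indexing the channels by
  the true sender makes them authenticated; using multisets makes the delays arbitrary (messages
  may overtake each other). \<open>delivered c p\<close> records all contents delivered by \<open>p\<close> so far. The last
  three fields are meaningful for correct nodes only.
\<close>

record ('a, 'm) config =
  chan :: "'a \<Rightarrow> 'a \<Rightarrow> ('a, 'm) msg multiset"
  wait :: "'a \<Rightarrow> ('m \<times> 'a) set"
  trig :: "'a \<Rightarrow> ('m \<times> 'a set) set"
  delivered :: "'a \<Rightarrow> 'm set"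

definition multicast ::
    "'a network \<Rightarrow> 'a \<Rightarrow> ('a, 'm) msg multiset \<Rightarrow> ('a, 'm) config \<Rightarrow> ('a, 'm) config" where
  "multicast N p M c =
     c\<lparr>chan := (\<lambda>u v. if u = p \<and> (u, v) \<in> edges N then chan c u v + M else chan c u v)\<rparr>"

definition deliver :: "'a network \<Rightarrow> 'a \<Rightarrow> 'm \<Rightarrow> ('a, 'm) config \<Rightarrow> ('a, 'm) config" where
  "deliver N p m c =
     multicast N p {#Std m, Trigger m {}#}
       (c\<lparr>delivered := (delivered c)(p := insert m (delivered c p))\<rparr>)"

definition init_config :: "'a network \<Rightarrow> 'm \<Rightarrow> ('a, 'm) config" where
  "init_config N m =
     deliver N (source N) m
       \<lparr>chan = (\<lambda>_ _. {#}), wait = (\<lambda>_. {}), trig = (\<lambda>_. {}), delivered = (\<lambda>_. {})\<rparr>"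

definition send :: "'a \<Rightarrow> 'a \<Rightarrow> ('a, 'm) msg \<Rightarrow> ('a, 'm) config \<Rightarrow> ('a, 'm) config" where
  "send u v x c = c\<lparr>chan := (chan c)(u := (chan c u)(v := add_mset x (chan c u v)))\<rparr>"

definition consume :: "'a \<Rightarrow> 'a \<Rightarrow> ('a, 'm) msg \<Rightarrow> ('a, 'm) config \<Rightarrow> ('a, 'm) config" where
  "consume u v x c = c\<lparr>chan := (chan c)(u := (chan c u)(v := chan c u v - {#x#}))\<rparr>"

text \<open>
  Rules RECEPTION and TRANSMISSION: reaction of the correct node \<open>p\<close> to a message from \<open>q\<close>.
  As \<open>card\<close> is \<open>0\<close> on infinite sets, the size test needs the explicit finiteness condition.
\<close>

fun react ::
    "'a network \<Rightarrow> nat \<Rightarrow> 'a \<Rightarrow> 'a \<Rightarrow> ('a, 'm) msg \<Rightarrow> ('a, 'm) config \<Rightarrow> ('a, 'm) config" where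
  "react N H p q (Std m) c =
     (if q = source N then deliver N p m c
      else c\<lparr>wait := (wait c)(p := insert (m, q) (wait c p))\<rparr>)"
| "react N H p q (Trigger m S) c =
     (if q \<notin> S \<and> finite S \<and> card S \<le> H - 1
      then multicast N p {#Trigger m (S \<union> {q})#}
             (c\<lparr>trig := (trig c)(p := insert (m, S \<union> {q}) (trig c p))\<rparr>)
      else c)"

definition may_decide :: "('a, 'm) config \<Rightarrow> 'a \<Rightarrow> 'm \<Rightarrow> bool" where
  "may_decide c p m \<longleftrightarrow> (\<exists>q S. (m, q) \<in> wait c p \<and> (m, S) \<in> trig c p \<and> q \<notin> S)"

text \<open>The first argument of each event is the node that is activated.\<close>

datatype ('a, 'm) event =
  Receive (actor: 'a) 'a "('a, 'm) msg"
| Decide (actor: 'a) 'm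
| Forge (actor: 'a) 'a "('a, 'm) msg"
| Idle (actor: 'a)

inductive step ::
    "'a network \<Rightarrow> nat \<Rightarrow> ('a, 'm) config \<Rightarrow> ('a, 'm) event \<Rightarrow> ('a, 'm) config \<Rightarrow> bool"
  for N :: "'a network" and H :: nat where
  receive_correct:
    "p \<in> correct N \<Longrightarrow> x \<in># chan c q p \<Longrightarrow>
       step N H c (Receive p q x) (react N H p q x (consume q p x c))"
| receive_byzantine:
    "b \<in> byzantine N \<Longrightarrow> x \<in># chan c q b \<Longrightarrow>
       step N H c (Receive b q x) (consume q b x c)"
| decide:
    "p \<in> correct N \<Longrightarrow> may_decide c p m \<Longrightarrow> step N H c (Decide p m) (deliver N p m c)"
| forge:
    "b \<in> byzantine N \<Longrightarrow> (b, v) \<in> edges N \<Longrightarrow> step N H c (Forge b v x) (send b v x c)"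
| idle:
    "p \<in> nodes N \<Longrightarrow> step N H c (Idle p) c"

text \<open>
  Fairness of an infinite execution: every message is eventually received, every node is activated
  infinitely often, and a rule DECISION that is enabled is eventually applied. The guard of DECISION
  is stable, so an earlier application to the same content also counts.
\<close>

definition fair ::
    "'a network \<Rightarrow> (nat \<Rightarrow> ('a, 'm) config) \<Rightarrow> (nat \<Rightarrow> ('a, 'm) event) \<Rightarrow> bool" where
  "fair N cfg ev \<longleftrightarrow>
     (\<forall>i p q x. x \<in># chan (cfg i) q p \<longrightarrow> (\<exists>j\<ge>i. ev j = Receive p q x)) \<and>
     (\<forall>i. \<forall>p\<in>nodes N. \<exists>j\<ge>i. actor (ev j) = p) \<and>
     (\<forall>i m. \<forall>p\<in>correct N. may_decide (cfg i) p m \<longrightarrow> (\<exists>j. ev j = Decide p m))"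

text \<open>
  An execution with authentic message \<open>m\<close> consists of \<open>L\<close> events, where \<open>L\<close> may be \<open>\<infinity>\<close>; event
  \<open>ev i\<close> leads from \<open>cfg i\<close> to \<open>cfg (Suc i)\<close>. Finite executions may stop at any point.
\<close>

definition execution ::
    "'a network \<Rightarrow> nat \<Rightarrow> 'm \<Rightarrow> enat \<Rightarrow> (nat \<Rightarrow> ('a, 'm) config) \<Rightarrow> (nat \<Rightarrow> ('a, 'm) event) \<Rightarrow> bool"
  where
  "execution N H m L cfg ev \<longleftrightarrow>
     cfg 0 = init_config N m \<and>
     (\<forall>i. enat i < L \<longrightarrow> step N H (cfg i) (ev i) (cfg (Suc i))) \<and>
     (L = \<infinity> \<longrightarrow> fair N cfg ev)"

end

theory Submission
  imports Defs
begin

text \<open>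
  Before any false delivery, a correct node neither sends a false standard message nor originates a
  false trigger message. Hence a false pair \<open>(m', q)\<close> in \<open>Wait\<close> comes from a Byzantine neighbor \<open>q\<close>,
  and a false pair \<open>(m', S)\<close> in \<open>Trig\<close> can be traced back to a Byzantine node \<open>b \<in> S\<close>. Each relay
  adds a new identifier to \<open>S\<close>, so \<open>b\<close> is at most \<open>card S \<le> H\<close> hops away. If \<open>q \<notin> S\<close>, then
  \<open>b \<noteq> q\<close> are Byzantine nodes at distance at most \<open>H + 1\<close>, so DECISION never applies to \<open>m'\<close>.
\<close>

text \<open>Finiteness of \<open>S\<close> makes \<open>card S\<close> grow by one whenever a new
  identifier is added, so \<open>card S\<close> can serve as a hop counter.\<close>

definition byz_route :: "'a network \<Rightarrow> 'a \<Rightarrow> 'a set \<Rightarrow> bool" where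
  "byz_route N p S \<longleftrightarrow>
     finite S \<and> (\<exists>b\<in>byzantine N \<inter> S. \<exists>n\<le>card S. (b, p) \<in> edges N ^^ n)"

fun safe_msg :: "'a network \<Rightarrow> 'm \<Rightarrow> 'a \<Rightarrow> ('a, 'm) msg \<Rightarrow> bool" where
  "safe_msg N m u (Std m') \<longleftrightarrow> u \<in> byzantine N \<or> m' = m"
| "safe_msg N m u (Trigger m' S) \<longleftrightarrow> u \<in> byzantine N \<or> m' = m \<or> byz_route N u S"

text \<open>The last three conjuncts need no restriction to correct nodes: events at Byzantine nodes
  change only \<open>chan\<close>, so the other fields of those nodes stay empty.\<close>

definition safe :: "'a network \<Rightarrow> nat \<Rightarrow> 'm \<Rightarrow> ('a, 'm) config \<Rightarrow> bool" where
  "safe N H m c \<longleftrightarrow>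
     (\<forall>u v x. x \<in># chan c u v \<longrightarrow> (u, v) \<in> edges N \<and> safe_msg N m u x) \<and>
     (\<forall>p m' q. (m', q) \<in> wait c p \<longrightarrow> m' = m \<or> q \<in> byzantine N \<and> (q, p) \<in> edges N) \<and>
     (\<forall>p m' S. (m', S) \<in> trig c p \<longrightarrow> m' = m \<or> byz_route N p S \<and> card S \<le> H) \<and>
     (\<forall>p. delivered c p \<subseteq> {m})"

text \<open>Any walk bounds the infimum, so shortest paths never have to be constructed.\<close>

lemma byz_dist_le:
  assumes "u \<in> byzantine N" "v \<in> byzantine N" "u \<noteq> v" "(u, v) \<in> edges N ^^ n"
  shows "byz_dist N \<le> enat n"
proof -
  have "byz_dist N \<le> hop_dist N u v"
    unfolding byz_dist_def using assms by (intro INF_lower2[of "(u, v)"]) auto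
  also have "\<dots> \<le> enat n"
    unfolding hop_dist_def using assms by (intro INF_lower) auto
  finally show ?thesis .
qed

text \<open>The set sent by a Byzantine neighbor \<open>b\<close> is arbitrary, but the receiver
  inserts the authenticated sender \<open>b\<close>, which is one hop away.\<close>

lemma byz_route_start:
  assumes "b \<in> byzantine N" "(b, p) \<in> edges N" "finite S"
  shows "byz_route N p (insert b S)"
proof -
  have "1 \<le> card (insert b S)"
    using assms by (simp add: card_gt_0_iff Suc_le_eq)
  moreover have "(b, p) \<in> edges N ^^ 1"
    using assms by simp
  ultimately show ?thesis
    unfolding byz_route_def using assms by blast
qed

text \<open>The relay adds one hop to the walk and, since \<open>q\<close> is new, exactly one
  element to the set.\<close>

lemma byz_route_extend:
  assumes "byz_route N q S" "(q, p) \<in> edges N" "q \<notin> S"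
  shows "byz_route N p (insert q S)"
proof -
  obtain b n where "finite S" "b \<in> byzantine N" "b \<in> S" "n \<le> card S" "(b, q) \<in> edges N ^^ n"
    using assms unfolding byz_route_def by blast
  moreover from this have "(b, p) \<in> edges N ^^ Suc n" "Suc n \<le> card (insert q S)"
    using assms by auto
  ultimately show ?thesis
    unfolding byz_route_def by blast
qed

lemma safe_consume: "safe N H m c \<Longrightarrow> safe N H m (consume u v x c)"
  unfolding safe_def consume_def by (auto dest: in_diffD)

lemma safe_send:
  assumes "safe N H m c" "b \<in> byzantine N" "(b, v) \<in> edges N"
  shows "safe N H m (send b v x c)"
proof -
  have "safe_msg N m b x"
    using assms(2) by (cases x) auto
  then show ?thesis
    using assms unfolding safe_def send_def by auto
qed

lemma safe_multicast:
  assumes "safe N H m c" "\<And>x. x \<in># M \<Longrightarrow> safe_msg N m p x"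
  shows "safe N H m (multicast N p M c)"
  using assms unfolding safe_def multicast_def by auto

text \<open>The authentic content is enough here: every delivery by a correct node is first shown to
  concern \<open>m\<close>.\<close>

lemma safe_deliver:
  assumes "safe N H m c"
  shows "safe N H m (deliver N p m c)"
  unfolding deliver_def
  by (rule safe_multicast) (use assms in \<open>auto simp: safe_def\<close>)

lemma safe_init: "safe N H m (init_config N m)"
  unfolding init_config_def by (rule safe_deliver) (simp add: safe_def)

lemma safe_multicast_trigger:
  assumes "safe N H m c" "m' = m \<or> byz_route N p S \<and> card S \<le> H"
  shows "safe N H m (multicast N p {#Trigger m' S#}
           (c\<lparr>trig := (trig c)(p := insert (m', S) (trig c p))\<rparr>))"
  by (rule safe_multicast) (use assms in \<open>auto simp: safe_def\<close>)

text \<open>Two configurations occur because \<open>x\<close> lies in a channel of \<open>c\<close>,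
  whereas the reaction acts on \<open>c'\<close>, the configuration after \<open>x\<close> has been
  consumed.\<close>

lemma safe_react:
  assumes wf: "wf_network N" and "H \<ge> 1" and safe: "safe N H m c" and safe': "safe N H m c'"
    and x: "x \<in># chan c q p"
  shows "safe N H m (react N H p q x c')"
proof -
  have edge: "(q, p) \<in> edges N" and msg: "safe_msg N m q x"
    using safe x unfolding safe_def by blast+
  show ?thesis
  proof (cases x)
    case (Std m')
    have m': "m' = m \<or> q \<in> byzantine N"
      using msg Std by auto
    show ?thesis
    proof (cases "q = source N")
      case True
      then have "m' = m"
        using m' wf unfolding wf_network_def by auto
      then show ?thesis
        using Std True safe' by (simp add: safe_deliver)
    next
      case False
      then show ?thesis
        using Std safe' m' edge unfolding safe_def by auto
    qed
  next
    case (Trigger m' S)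
    show ?thesis
    proof (cases "q \<notin> S \<and> finite S \<and> card S \<le> H - 1")
      case True
      then have q: "q \<notin> S" "finite S" "card S \<le> H - 1"
        by auto
      \<comment> \<open>A false trigger message has either a Byzantine sender, which starts a route,
        or a sender that already has a route, which is extended.\<close>
      have "m' = m \<or> byz_route N p (insert q S)"
        using msg Trigger byz_route_start[OF _ edge q(2)] byz_route_extend[OF _ edge q(1)] by auto
      \<comment> \<open>Subtraction is truncated, so \<open>H \<ge> 1\<close> is what turns
        \<open>card S \<le> H - 1\<close> into this bound.\<close>
      moreover have "card (insert q S) \<le> H"
        using q \<open>H \<ge> 1\<close> by simp
      ultimately show ?thesis
        using Trigger True safe_multicast_trigger[OF safe', of m' p "insert q S"] by simp
    next
      case False
      then show ?thesis
        using Trigger safe' by auto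
    qed
  qed
qed

lemma may_decide_authentic:
  assumes dist: "byz_dist N \<ge> enat (H + 2)" and safe: "safe N H m c"
    and dec: "may_decide c p m'" and sym: "sym (edges N)"
  shows "m' = m"
proof (rule ccontr)
  assume "m' \<noteq> m"
  obtain q S where wait: "(m', q) \<in> wait c p" and trig: "(m', S) \<in> trig c p" and "q \<notin> S"
    using dec unfolding may_decide_def by blast
  have q: "q \<in> byzantine N" "(q, p) \<in> edges N"
    using safe wait \<open>m' \<noteq> m\<close> unfolding safe_def by blast+
  have "byz_route N p S" and card: "card S \<le> H"
    using safe trig \<open>m' \<noteq> m\<close> unfolding safe_def by blast+
  then obtain b n where b: "b \<in> byzantine N" "b \<in> S" "n \<le> card S" "(b, p) \<in> edges N ^^ n"
    unfolding byz_route_def by blast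
  \<comment> \<open>The edge along which \<open>q\<close> sent to \<open>p\<close> is reversed to
    prolong the walk from \<open>b\<close> to \<open>p\<close> up to \<open>q\<close>.\<close>
  have "(p, q) \<in> edges N"
    using sym q by (auto dest: symD)
  then have "(b, q) \<in> edges N ^^ Suc n"
    using b by auto
  then have "byz_dist N \<le> enat (Suc n)"
    using b q \<open>q \<notin> S\<close> by (intro byz_dist_le[of b N q]) auto
  then have "enat (H + 2) \<le> enat (Suc n)"
    using dist by (rule order_trans[rotated])
  then show False
    using b card by simp
qed

lemma safe_step:
  assumes wf: "wf_network N" and H: "H \<ge> 1" and dist: "byz_dist N \<ge> enat (H + 2)"
    and "step N H c e c'" and safe: "safe N H m c"
  shows "safe N H m c'"
  using assms(4)
proof cases
  case receive_correct
  then show ?thesis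
    using safe_react[OF wf H safe safe_consume[OF safe]] by simp
next
  case receive_byzantine
  then show ?thesis
    using safe by (simp add: safe_consume)
next
  case (decide p m')
  then have "m' = m"
    using may_decide_authentic[OF dist safe] wf unfolding wf_network_def by blast
  then show ?thesis
    using decide safe by (simp add: safe_deliver)
next
  case forge
  then show ?thesis
    using safe by (simp add: safe_send)
next
  case idle
  then show ?thesis
    using safe by simp
qed

theorem theorem1:
  fixes N :: "'a network" and H :: nat and m :: 'm and L :: enat
    and cfg :: "nat \<Rightarrow> ('a, 'm) config" and ev :: "nat \<Rightarrow> ('a, 'm) event"
  assumes "wf_network N"
    and "H \<ge> 1"
    and "byz_dist N \<ge> enat (H + 2)"
    and "execution N H m L cfg ev"
  shows "\<not> (\<exists>p\<in>correct N. \<exists>i m'. enat i \<le> L \<and> m' \<in> delivered (cfg i) p \<and> m' \<noteq> m)"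
proof -
  \<comment> \<open>\<open>L\<close> events determine the configurations up to index
    \<open>L\<close> inclusive; later values of \<open>cfg\<close> are unconstrained.\<close>
  have "safe N H m (cfg i)" if "enat i \<le> L" for i
    using that
  proof (induction i)
    case 0
    then show ?case
      using assms(4) by (simp add: execution_def safe_init)
  next
    case (Suc i)
    then have i: "enat i < L"
      by (simp add: Suc_ile_eq)
    then have "step N H (cfg i) (ev i) (cfg (Suc i))"
      using assms(4) by (simp add: execution_def)
    then show ?case
      by (rule safe_step[OF assms(1-3)]) (use Suc.IH i in simp)
  qed
  then have "delivered (cfg i) p \<subseteq> {m}" if "enat i \<le> L" for i p
    using that unfolding safe_def by blast
  then show ?thesis
    by blast
qed

end
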